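(* Let $A\in\mathbb M_n(\mathbb C)$ and let $A^c$ be the conjugate of $A$. Then $A^c=A^*$ if and only if $A$ is normal, where $A^*$ denotes the Hermitian transpose of $A$.
   Context: $\mathbb M_n(\mathbb C)$ is the set of complex $n\times n$ matrices. The conjugate $A^c$ of $A\in\mathbb M_n(\mathbb C)$ is defined as follows: write $A=T(D+N)T^{-1}$ in Jordan canonical form, where $D=\mathrm{diag}(\lambda_1,\dots,\lambda_n)$ is the diagonal matrix of eigenvalues and $N$ is the nilpotent part (with possible 1's on the first superdiagonal); then $A^c:=T\overline D T^{-1}$ with $\overline D=\mathrm{diag}(\overline{\lambda_1},\dots,\overline{\lambda_n})$. *)

theory Defs
  imports
    "Jordan_Normal_Form.Jordan_Normal_Form_Existence"
    "Jordan_Normal_Form.Schur_Decomposition"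
begin

text \<open>
  \<open>is_mat_conj A C\<close>: for some Jordan decomposition \<open>A = T (D + N) T\<inverse>\<close>, where \<open>D + N\<close> is
  \<^const>\<open>jordan_matrix\<close> \<open>n_as\<close> with diagonal part \<open>D\<close>, the matrix \<open>C\<close> is \<open>T D' T\<inverse>\<close>, with \<open>D'\<close> the
  entrywise complex conjugate of \<open>D\<close>. The witness \<open>T'\<close> is the inverse of \<open>T\<close>. As in
  \<^const>\<open>jordan_nf\<close>, blocks of size 0 are excluded.
\<close>
definition is_mat_conj :: "complex mat \<Rightarrow> complex mat \<Rightarrow> bool" where
  "is_mat_conj A C \<longleftrightarrow>
     (\<exists>n_as T T'. 0 \<notin> fst ` set n_as
        \<and> similar_mat_wit A (jordan_matrix n_as) T T'
        \<and> C = T * mat_diag (dim_row A) (\<lambda>i. cnj (jordan_matrix n_as $$ (i, i))) * T')"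

definition mat_conj :: "complex mat \<Rightarrow> complex mat" where
  "mat_conj A = (THE C. is_mat_conj A C)"

definition normal_mat :: "complex mat \<Rightarrow> bool" where
  "normal_mat A \<longleftrightarrow> A * mat_adjoint A = mat_adjoint A * A"

lemma mat_adjoint_index:
  assumes "i < dim_col A" "j < dim_row A"
  shows "mat_adjoint A $$ (i, j) = cnj (A $$ (j, i))"
  using assms by (simp add: mat_adjoint_def mat_of_rows_def)

lemma jordan_matrix_bidiagonal:
  fixes n_as :: "(nat \<times> complex) list"
  defines "J \<equiv> jordan_matrix n_as" and "n \<equiv> sum_list (map fst n_as)"
  assumes "i < n" "j < n" "j \<noteq> i"
  shows "J $$ (i, j) = 0 \<or> (j = Suc i \<and> J $$ (j, j) = J $$ (i, i))"
  using assms(3-) unfolding J_def n_def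
proof (induction n_as arbitrary: i j)
  case Nil
  then show ?case by simp
next
  case (Cons na n_as)
  obtain m a where na: "na = (m, a)" by force
  let ?n = "sum_list (map fst n_as)"
  have J: "jordan_matrix (na # n_as) $$ (k, l) =
      (if k < m then if l < m then jordan_block m a $$ (k, l) else 0
       else if l < m then 0 else jordan_matrix n_as $$ (k - m, l - m))"
    if "k < m + ?n" "l < m + ?n" for k l
    using that unfolding na jordan_matrix_Cons by (subst index_mat_four_block) auto
  have ij: "i < m + ?n" "j < m + ?n" "j \<noteq> i" using Cons.prems by (auto simp: na)
  show ?case
  proof (cases "i < m \<or> j < m")
    case True
    then show ?thesis using ij by (auto simp: J)
  next
    case False
    then have "i - m < ?n" "j - m < ?n" "j - m \<noteq> i - m" using ij by auto
    from Cons.IH[OF this] False show ?thesis using ij by (auto simp: J)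
  qed
qed

lemma is_mat_conj_exists:
  assumes "A \<in> carrier_mat n n"
  shows "\<exists>C. is_mat_conj A C"
proof -
  obtain as where "char_poly A = (\<Prod>a\<leftarrow>as. [:- a, 1:])"
    using char_poly_factorized[OF assms] by blast
  from jordan_nf_exists[OF assms this] show ?thesis
    unfolding jordan_nf_def similar_mat_def is_mat_conj_def by blast
qed

lemma is_mat_conj_unique:
  assumes "is_mat_conj A C1" "is_mat_conj A C2"
  shows "C1 = C2"
proof -
  define n where "n = dim_row A"
  obtain as P P' where w1: "similar_mat_wit A (jordan_matrix as) P P'"
    and C1: "C1 = P * mat_diag n (\<lambda>i. cnj (jordan_matrix as $$ (i, i))) * P'"
    using assms(1) unfolding is_mat_conj_def n_def by blast
  obtain bs Q Q' where w2: "similar_mat_wit A (jordan_matrix bs) Q Q'"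
    and C2: "C2 = Q * mat_diag n (\<lambda>i. cnj (jordan_matrix bs $$ (i, i))) * Q'"
    using assms(2) unfolding is_mat_conj_def n_def by blast
  define J K where "J = jordan_matrix as" and "K = jordan_matrix bs"
  note d1 = similar_mat_witD[OF n_def w1[folded J_def]]
  note d2 = similar_mat_witD[OF n_def w2[folded K_def]]
  note c [simp] = d1(4-7) d2(5-7)
  note PP = d1(1,2) and AP = d1(3) and QQ = d2(1,2) and AQ = d2(3)
  have m: "X * Y \<in> carrier_mat n n" if "X \<in> carrier_mat n n" "Y \<in> carrier_mat n n"
    for X Y :: "complex mat"
    using that by (rule mult_carrier_mat)
  have assoc: "X * Y * Z = X * (Y * Z)"
    if "X \<in> carrier_mat n n" "Y \<in> carrier_mat n n" "Z \<in> carrier_mat n n" for X Y Z :: "complex mat"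
    using that by (rule assoc_mult_mat)
  have entry: "(X * Y) $$ (i, j) = (\<Sum>k<n. X $$ (i, k) * Y $$ (k, j))"
    if "X \<in> carrier_mat n n" "Y \<in> carrier_mat n n" "i < n" "j < n" for X Y :: "complex mat" and i j
    using that by (auto simp: scalar_prod_def lessThan_atLeast0 intro!: sum.cong)
  have one: "1\<^sub>m n * X = X" "X * 1\<^sub>m n = X" if "X \<in> carrier_mat n n" for X :: "complex mat"
    using that by auto
  have QQl: "Q' * (Q * X) = X" "Q * (Q' * X) = X" if "X \<in> carrier_mat n n" for X
    using that by (simp_all add: assoc[symmetric] QQ one)
  define S where "S = Q' * P"
  have [simp]: "S \<in> carrier_mat n n" unfolding S_def by (rule m) auto
  have "K * S = Q' * (Q * K * Q') * P"
    by (simp add: S_def assoc m QQl)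
  also have "\<dots> = Q' * (P * J * P') * P" using AP AQ by simp
  also have "\<dots> = S * J" by (simp add: S_def assoc m PP one)
  finally have KS: "K * S = S * J" .
  have dimJ: "n = sum_list (map fst as)" and dimK: "n = sum_list (map fst bs)"
    using d1(5) d2(5) unfolding J_def K_def by auto
  have bJ: "J $$ (i, j) = 0 \<or> (j = Suc i \<and> J $$ (j, j) = J $$ (i, i))"
    and bK: "K $$ (i, j) = 0 \<or> (j = Suc i \<and> K $$ (j, j) = K $$ (i, i))"
    if "i < n" "j < n" "j \<noteq> i" for i j
    using that jordan_matrix_bidiagonal[of i as j] jordan_matrix_bidiagonal[of i bs j] dimJ dimK
    unfolding J_def K_def by auto
  have S0: "S $$ (i, j) = 0"
    if "i < n" "j < n" "K $$ (i, i) \<noteq> J $$ (j, j)" for i j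
    using that
  proof (induction "(n - i) + j" arbitrary: i j rule: less_induct)
    case less
    have "(\<Sum>k<n. K $$ (i, k) * S $$ (k, j)) = (K * S) $$ (i, j)"
      using less.prems by (subst entry) auto
    also have "\<dots> = (\<Sum>k<n. S $$ (i, k) * J $$ (k, j))"
      unfolding KS using less.prems by (subst entry) auto
    finally have eq: "(\<Sum>k<n. K $$ (i, k) * S $$ (k, j)) = (\<Sum>k<n. S $$ (i, k) * J $$ (k, j))" .
    have z1: "K $$ (i, k) * S $$ (k, j) = 0" if "k < n" "k \<noteq> i" for k
    proof (cases "K $$ (i, k) = 0")
      case False
      then have "k = Suc i" "K $$ (k, k) = K $$ (i, i)" using bK[of i k] that less.prems by auto
      then have "S $$ (k, j) = 0" using less that by (intro less.hyps) auto
      then show ?thesis by simp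
    qed simp
    have z2: "S $$ (i, k) * J $$ (k, j) = 0" if "k < n" "k \<noteq> j" for k
    proof (cases "J $$ (k, j) = 0")
      case False
      then have "j = Suc k" "J $$ (j, j) = J $$ (k, k)" using bJ[of k j] that less.prems by auto
      then have "S $$ (i, k) = 0" using less that by (intro less.hyps) auto
      then show ?thesis by simp
    qed simp
    have "(\<Sum>k<n. K $$ (i, k) * S $$ (k, j)) = K $$ (i, i) * S $$ (i, j)"
      using less.prems by (subst sum.remove[of _ i]) (auto intro!: sum.neutral dest: z1)
    moreover have "(\<Sum>k<n. S $$ (i, k) * J $$ (k, j)) = S $$ (i, j) * J $$ (j, j)"
      using less.prems by (subst sum.remove[of _ j]) (auto intro!: sum.neutral dest: z2)
    ultimately show ?case using eq less.prems by auto
  qed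
  define D E where "D = mat_diag n (\<lambda>i. cnj (J $$ (i, i)))"
    and "E = mat_diag n (\<lambda>i. cnj (K $$ (i, i)))"
  have [simp]: "D \<in> carrier_mat n n" "E \<in> carrier_mat n n" unfolding D_def E_def by auto
  have ES: "E * S = S * D"
    unfolding D_def E_def
    by (subst mat_diag_mult_left[of _ n n], simp, subst mat_diag_mult_right[of _ n n], simp)
      (rule eq_matI, use S0 in \<open>auto simp: mult.commute\<close>)
  have QS: "Q * S = P" by (simp add: S_def QQl)
  have SP: "S * P' = Q'" by (simp add: S_def assoc m PP one)
  have "C1 = Q * S * D * P'" using C1 unfolding D_def J_def QS by simp
  also have "\<dots> = Q * (S * D) * P'" by (simp add: assoc m)
  also have "\<dots> = Q * (E * S) * P'" by (simp add: ES)
  also have "\<dots> = Q * E * (S * P')" by (simp add: assoc m)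
  also have "\<dots> = C2" unfolding SP C2 E_def K_def by simp
  finally show ?thesis .
qed

lemma is_mat_conj_mat_conj:
  assumes "A \<in> carrier_mat n n"
  shows "is_mat_conj A (mat_conj A)"
  unfolding mat_conj_def
  using is_mat_conj_exists[OF assms] is_mat_conj_unique by (blast intro: theI)

end

theory Submission
  imports Defs
begin

text \<open>
  The diagonal part of a Jordan matrix commutes with the matrix, also after conjugating its entries,
  so \<open>A\<close> always commutes with \<open>A\<^sup>c\<close>; hence \<open>A\<^sup>c = A\<^sup>*\<close> makes \<open>A\<close> normal. Conversely, every shift
  \<open>M = A - \<lambda>\<close> of a normal matrix is normal, so \<open>ker M = ker M\<^sup>*\<close> and \<open>ker M\<^sup>2 = ker M\<close>. By the latter,
  all columns of \<open>T\<close> (and not only the first one of each Jordan block) are eigenvectors of \<open>A\<close>; by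
  the former, they are eigenvectors of \<open>A\<^sup>*\<close> for the conjugate eigenvalues, which says
  \<open>A\<^sup>* T = T D'\<close> with \<open>D'\<close> the conjugate of \<open>D\<close>.
\<close>

section \<open>Adjoints and kernels of normal matrices\<close>

lemma mat_adjoint_carrier:
  fixes A :: "complex mat"
  assumes "A \<in> carrier_mat m n"
  shows "mat_adjoint A \<in> carrier_mat n m"
  using assms by (auto simp: mat_adjoint_def mat_of_rows_def)

lemma mat_adjoint_swap:
  fixes A :: "complex mat"
  assumes A: "A \<in> carrier_mat m n" and v: "v \<in> carrier_vec n" and w: "w \<in> carrier_vec m"
  shows "(A *\<^sub>v v) \<bullet>c w = v \<bullet>c (mat_adjoint A *\<^sub>v w)"
proof -
  have adj: "dim_row (mat_adjoint A) = n" "dim_col (mat_adjoint A) = m"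
    using mat_adjoint_carrier[OF A] by auto
  have "(A *\<^sub>v v) \<bullet>c w = (\<Sum>i<m. \<Sum>j<n. A $$ (i, j) * v $ j * cnj (w $ i))"
    using A v w by (simp add: scalar_prod_def sum_distrib_right lessThan_atLeast0)
  also have "\<dots> = (\<Sum>j<n. \<Sum>i<m. A $$ (i, j) * v $ j * cnj (w $ i))"
    by (rule sum.swap)
  also have "\<dots> = v \<bullet>c (mat_adjoint A *\<^sub>v w)"
    using A v w adj
    by (simp add: scalar_prod_def sum_distrib_left lessThan_atLeast0 mat_adjoint_index mult_ac)
  finally show ?thesis .
qed

text \<open>Writing B for the adjoint, normality gives A B v = B A v = 0. Moving A across the inner
  product turns <A B v, v> = 0 into <B v, B v> = 0, and the product is definite.\<close>

lemma normal_mat_kernel_adjoint: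
  assumes A: "A \<in> carrier_mat n n" and N: "normal_mat A" and v: "v \<in> carrier_vec n"
    and 0: "A *\<^sub>v v = 0\<^sub>v n"
  shows "mat_adjoint A *\<^sub>v v = 0\<^sub>v n"
proof -
  let ?B = "mat_adjoint A"
  have B: "?B \<in> carrier_mat n n" by (rule mat_adjoint_carrier[OF A])
  have "A *\<^sub>v (?B *\<^sub>v v) = ?B *\<^sub>v (A *\<^sub>v v)"
    using N assoc_mult_mat_vec[OF A B v] assoc_mult_mat_vec[OF B A v] by (simp add: normal_mat_def)
  also have "\<dots> = 0\<^sub>v n" unfolding 0 using B by (intro eq_vecI) auto
  finally have AB: "A *\<^sub>v (?B *\<^sub>v v) = 0\<^sub>v n" .
  have "(A *\<^sub>v (?B *\<^sub>v v)) \<bullet>c v = (?B *\<^sub>v v) \<bullet>c (?B *\<^sub>v v)"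
    using A B v by (intro mat_adjoint_swap) auto
  then have "(?B *\<^sub>v v) \<bullet>c (?B *\<^sub>v v) = 0" using v unfolding AB by simp
  then show ?thesis using B v by (subst (asm) conjugate_square_eq_0_vec) auto
qed

text \<open>The vector A v lies in the kernel of A, hence in that of the adjoint, so <A v, A v> =
  <v, A* A v> = 0.\<close>

lemma normal_mat_kernel_square:
  assumes A: "A \<in> carrier_mat n n" and N: "normal_mat A" and v: "v \<in> carrier_vec n"
    and 0: "A *\<^sub>v (A *\<^sub>v v) = 0\<^sub>v n"
  shows "A *\<^sub>v v = 0\<^sub>v n"
proof -
  have Av: "A *\<^sub>v v \<in> carrier_vec n" using A v by simp
  have "(A *\<^sub>v v) \<bullet>c (A *\<^sub>v v) = v \<bullet>c (mat_adjoint A *\<^sub>v (A *\<^sub>v v))"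
    by (rule mat_adjoint_swap[OF A v Av])
  also have "\<dots> = 0" using v by (simp add: normal_mat_kernel_adjoint[OF A N Av 0])
  finally show ?thesis using Av by (subst (asm) conjugate_square_eq_0_vec) auto
qed

section \<open>Scalar shifts and eigenvectors of the adjoint\<close>

lemma mat_adjoint_shift:
  fixes A :: "complex mat"
  assumes A: "A \<in> carrier_mat n n"
  shows "mat_adjoint (A - c \<cdot>\<^sub>m 1\<^sub>m n) = mat_adjoint A - cnj c \<cdot>\<^sub>m 1\<^sub>m n"
proof (rule eq_matI)
  have M: "A - c \<cdot>\<^sub>m 1\<^sub>m n \<in> carrier_mat n n" by (simp add: minus_carrier_mat)
  have dims: "dim_row (mat_adjoint A) = n" "dim_col (mat_adjoint A) = n"
      "dim_row (mat_adjoint (A - c \<cdot>\<^sub>m 1\<^sub>m n)) = n" "dim_col (mat_adjoint (A - c \<cdot>\<^sub>m 1\<^sub>m n)) = n"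
    using mat_adjoint_carrier[OF A] mat_adjoint_carrier[OF M] by auto
  then show "dim_row (mat_adjoint (A - c \<cdot>\<^sub>m 1\<^sub>m n)) = dim_row (mat_adjoint A - cnj c \<cdot>\<^sub>m 1\<^sub>m n)"
    and "dim_col (mat_adjoint (A - c \<cdot>\<^sub>m 1\<^sub>m n)) = dim_col (mat_adjoint A - cnj c \<cdot>\<^sub>m 1\<^sub>m n)"
    by auto
  fix i j
  assume "i < dim_row (mat_adjoint A - cnj c \<cdot>\<^sub>m 1\<^sub>m n)" "j < dim_col (mat_adjoint A - cnj c \<cdot>\<^sub>m 1\<^sub>m n)"
  then have "i < n" "j < n" by auto
  then show "mat_adjoint (A - c \<cdot>\<^sub>m 1\<^sub>m n) $$ (i, j) = (mat_adjoint A - cnj c \<cdot>\<^sub>m 1\<^sub>m n) $$ (i, j)"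
    using A dims by (simp add: mat_adjoint_index)
qed

lemma shift_mult_vec:
  fixes A :: "complex mat"
  assumes "A \<in> carrier_mat n n" "v \<in> carrier_vec n"
  shows "(A - c \<cdot>\<^sub>m 1\<^sub>m n) *\<^sub>v v = A *\<^sub>v v - c \<cdot>\<^sub>v v"
proof -
  have "(c \<cdot>\<^sub>m 1\<^sub>m n) *\<^sub>v v = c \<cdot>\<^sub>v (1\<^sub>m n *\<^sub>v v)"
    using assms(2) by (intro eq_vecI) auto
  then show ?thesis
    using assms minus_mult_distrib_mat_vec[of A n n "c \<cdot>\<^sub>m 1\<^sub>m n" v] by simp
qed

lemma normal_mat_shift:
  assumes A: "A \<in> carrier_mat n n" and N: "normal_mat A"
  shows "normal_mat (A - c \<cdot>\<^sub>m 1\<^sub>m n)"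
proof -
  let ?B = "mat_adjoint A"
  have B: "?B \<in> carrier_mat n n" by (rule mat_adjoint_carrier[OF A])
  \<comment> \<open>Kept general in X, Y, a, b so that it serves both orders of the product;
    afterwards the two sides differ only in \<open>X * Y\<close> against \<open>Y * X\<close>, where
    normality enters.\<close>
  have expand: "(X - a \<cdot>\<^sub>m 1\<^sub>m n) * (Y - b \<cdot>\<^sub>m 1\<^sub>m n) = X * Y - b \<cdot>\<^sub>m X - (a \<cdot>\<^sub>m Y - (a * b) \<cdot>\<^sub>m 1\<^sub>m n)"
    if "X \<in> carrier_mat n n" "Y \<in> carrier_mat n n" for X Y :: "complex mat" and a b
  proof -
    have "(a \<cdot>\<^sub>m 1\<^sub>m n) * (b \<cdot>\<^sub>m 1\<^sub>m n :: complex mat) = (a * b) \<cdot>\<^sub>m 1\<^sub>m n"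
      by (simp add: mult_smult_assoc_mat[of _ n n _ n] mult_smult_distrib[of _ n n _ n])
        (intro eq_matI, auto)
    then show ?thesis
      using that
      by (simp add: minus_mult_distrib_mat[of _ n n _ _ n] mult_minus_distrib_mat[of _ n n _ n]
          mult_smult_distrib[of _ n n _ n] mult_smult_assoc_mat[of _ n n _ n] minus_carrier_mat)
        (intro eq_matI, auto simp: algebra_simps)
  qed
  have "(A - c \<cdot>\<^sub>m 1\<^sub>m n) * (?B - cnj c \<cdot>\<^sub>m 1\<^sub>m n) = (?B - cnj c \<cdot>\<^sub>m 1\<^sub>m n) * (A - c \<cdot>\<^sub>m 1\<^sub>m n)"
    unfolding expand[OF A B] expand[OF B A] using A B N
    by (intro eq_matI) (auto simp: normal_mat_def mult.commute)
  then show ?thesis unfolding normal_mat_def mat_adjoint_shift[OF A] .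
qed

text \<open>An eigenvector is a kernel vector of the shift A - c, which is again normal and whose
  adjoint is A* - cnj c.\<close>

lemma normal_mat_eigenvector_adjoint:
  assumes A: "A \<in> carrier_mat n n" and N: "normal_mat A" and v: "v \<in> carrier_vec n"
    and ev: "A *\<^sub>v v = c \<cdot>\<^sub>v v"
  shows "mat_adjoint A *\<^sub>v v = cnj c \<cdot>\<^sub>v v"
proof -
  have "(A - c \<cdot>\<^sub>m 1\<^sub>m n) *\<^sub>v v = 0\<^sub>v n" using A v by (simp add: shift_mult_vec ev)
  then have "mat_adjoint (A - c \<cdot>\<^sub>m 1\<^sub>m n) *\<^sub>v v = 0\<^sub>v n"
    using A v by (intro normal_mat_kernel_adjoint normal_mat_shift N) auto
  then have 0: "mat_adjoint A *\<^sub>v v - cnj c \<cdot>\<^sub>v v = 0\<^sub>v n"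
    using A v by (simp add: mat_adjoint_shift shift_mult_vec[OF mat_adjoint_carrier])
  show ?thesis
  proof (rule eq_vecI)
    fix i assume "i < dim_vec (cnj c \<cdot>\<^sub>v v)"
    then show "(mat_adjoint A *\<^sub>v v) $ i = (cnj c \<cdot>\<^sub>v v) $ i"
      using arg_cong[OF 0, of "\<lambda>u. u $ i"] v by simp
  qed (use mat_adjoint_carrier[OF A] v in auto)
qed

section \<open>Commutation of a matrix with its conjugate\<close>

text \<open>A nonzero entry of J off the diagonal joins two equal diagonal entries, so scaling its
  row or its column by the conjugates has the same effect.\<close>

lemma jordan_matrix_commute_conj_diag:
  fixes n_as :: "(nat \<times> complex) list"
  defines "J \<equiv> jordan_matrix n_as" and "n \<equiv> sum_list (map fst n_as)"
  shows "J * mat_diag n (\<lambda>i. cnj (J $$ (i, i))) = mat_diag n (\<lambda>i. cnj (J $$ (i, i))) * J"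
proof -
  have J: "J \<in> carrier_mat n n" unfolding J_def n_def by simp
  have "J $$ (i, j) * cnj (J $$ (j, j)) = cnj (J $$ (i, i)) * J $$ (i, j)" if "i < n" "j < n" for i j
    using jordan_matrix_bidiagonal[of i n_as j] that unfolding J_def n_def
    by (cases "i = j") auto
  then show ?thesis
    unfolding mat_diag_mult_left[OF J] mat_diag_mult_right[OF J] by (intro eq_matI) auto
qed

lemma is_mat_conj_commute:
  assumes A: "A \<in> carrier_mat n n" and C: "is_mat_conj A C"
  shows "A * C = C * A"
proof -
  obtain n_as T T' where w: "similar_mat_wit A (jordan_matrix n_as) T T'"
    and C: "C = T * mat_diag (dim_row A) (\<lambda>i. cnj (jordan_matrix n_as $$ (i, i))) * T'"
    using C unfolding is_mat_conj_def by blast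
  note w = similar_mat_witD2[OF A w]
  define J D where "J = jordan_matrix n_as" and "D = mat_diag n (\<lambda>i. cnj (J $$ (i, i)))"
  have J: "J \<in> carrier_mat n n" and D: "D \<in> carrier_mat n n"
    using w(5) unfolding J_def D_def by auto
  have "n = sum_list (map fst n_as)" using w(5) by auto
  then have JD: "J * D = D * J" unfolding D_def J_def by (simp add: jordan_matrix_commute_conj_diag)
  \<comment> \<open>Similarity by T is multiplicative, which carries \<open>J * D = D * J\<close>
    over to A and C.\<close>
  have conj: "(T * X * T') * (T * Y * T') = T * (X * Y) * T'"
    if X: "X \<in> carrier_mat n n" and Y: "Y \<in> carrier_mat n n" for X Y
  proof -
    have "(T * X * T') * (T * Y * T') = T * X * (T' * T) * Y * T'"
      using X Y w(6,7) by (simp add: assoc_mult_mat[of _ n n _ n _ n])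
    then show ?thesis using X Y w(6,7) by (simp add: w(2) assoc_mult_mat[of _ n n _ n _ n])
  qed
  have "A = T * J * T'" "C = T * D * T'" using w(3) A C unfolding J_def D_def by auto
  then show ?thesis by (simp add: conj J D JD)
qed

section \<open>Jordan bases of normal matrices\<close>

text \<open>This is column j of A T = T J, where J has at most two nonzero entries in that column.
  The second alternative records that both basis vectors involved belong to the same
  eigenvalue.\<close>

lemma jordan_basis_column:
  fixes n_as :: "(nat \<times> complex) list"
  assumes A: "A \<in> carrier_mat n n" and w: "similar_mat_wit A (jordan_matrix n_as) T T'" and j: "j < n"
  defines "J \<equiv> jordan_matrix n_as"
  shows "A *\<^sub>v col T j = J $$ (j, j) \<cdot>\<^sub>v col T j
    \<or> (\<exists>i. j = Suc i \<and> J $$ (i, i) = J $$ (j, j)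
        \<and> A *\<^sub>v col T j = J $$ (j, j) \<cdot>\<^sub>v col T j + J $$ (i, j) \<cdot>\<^sub>v col T i)"
proof -
  note w = similar_mat_witD2[OF A w, folded J_def]
  have n: "n = sum_list (map fst n_as)" using w(5) unfolding J_def by auto
  have bi: "J $$ (k, j) = 0 \<or> (j = Suc k \<and> J $$ (j, j) = J $$ (k, k))" if "k < n" "k \<noteq> j" for k
    using jordan_matrix_bidiagonal[of k n_as j] that j unfolding J_def n by auto
  have "A * T = T * J * (T' * T)" unfolding w(3) using w(5-7) by (simp add: assoc_mult_mat[of _ n n _ n _ n])
  then have AT: "A * T = T * J" using w(2,5,6) by simp
  have "A *\<^sub>v col T j = col (A * T) j" by (rule col_mult2[OF A w(6) j, symmetric])
  then have entry: "(A *\<^sub>v col T j) $ r = (\<Sum>k<n. T $$ (r, k) * J $$ (k, j))" if "r < n" for r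
    unfolding AT using w(5,6) j that by (simp add: scalar_prod_def lessThan_atLeast0)
  have Av: "dim_vec (A *\<^sub>v col T j) = n" using A by simp
  show ?thesis
  \<comment> \<open>The negative case covers both j = 0 and a zero entry just above the
    diagonal.\<close>
  proof (cases "\<exists>i. j = Suc i \<and> J $$ (i, j) \<noteq> 0")
    case True
    then obtain i where i: "j = Suc i" "J $$ (i, j) \<noteq> 0" by blast
    have eq: "J $$ (i, i) = J $$ (j, j)" using bi[of i] i j by auto
    have z: "J $$ (k, j) = 0" if "k < n" "k \<noteq> j" "k \<noteq> i" for k using bi[of k] that i by auto
    have "A *\<^sub>v col T j = J $$ (j, j) \<cdot>\<^sub>v col T j + J $$ (i, j) \<cdot>\<^sub>v col T i"
    proof (rule eq_vecI)
      fix r assume "r < dim_vec (J $$ (j, j) \<cdot>\<^sub>v col T j + J $$ (i, j) \<cdot>\<^sub>v col T i)"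
      then have r: "r < n" using w(6) by simp
      have "(\<Sum>k<n. T $$ (r, k) * J $$ (k, j)) = (\<Sum>k\<in>{i, j}. T $$ (r, k) * J $$ (k, j))"
        using i j z by (intro sum.mono_neutral_right) auto
      then show "(A *\<^sub>v col T j) $ r = (J $$ (j, j) \<cdot>\<^sub>v col T j + J $$ (i, j) \<cdot>\<^sub>v col T i) $ r"
        using r i(1) j w(6) unfolding entry[OF r] by simp
    qed (use Av w(6) in auto)
    then show ?thesis using i(1) eq by blast
  next
    case False
    then have z: "J $$ (k, j) = 0" if "k < n" "k \<noteq> j" for k using bi[of k] that by auto
    have "A *\<^sub>v col T j = J $$ (j, j) \<cdot>\<^sub>v col T j"
    proof (rule eq_vecI)
      fix r assume "r < dim_vec (J $$ (j, j) \<cdot>\<^sub>v col T j)"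
      then have r: "r < n" using w(6) by simp
      have "(\<Sum>k<n. T $$ (r, k) * J $$ (k, j)) = (\<Sum>k\<in>{j}. T $$ (r, k) * J $$ (k, j))"
        using j z by (intro sum.mono_neutral_right) auto
      then show "(A *\<^sub>v col T j) $ r = (J $$ (j, j) \<cdot>\<^sub>v col T j) $ r"
        using r j w(6) unfolding entry[OF r] by simp
    qed (use Av w(6) in auto)
    then show ?thesis by blast
  qed
qed

text \<open>Induction along the Jordan chain: if the preceding column is an eigenvector for the same
  eigenvalue, the shift M sends column j into its own kernel, and for normal M this already forces M
  to kill column j.\<close>

lemma normal_mat_jordan_basis_eigenvector:
  assumes A: "A \<in> carrier_mat n n" and N: "normal_mat A"
    and w: "similar_mat_wit A (jordan_matrix n_as) T T'" and j: "j < n"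
  shows "A *\<^sub>v col T j = jordan_matrix n_as $$ (j, j) \<cdot>\<^sub>v col T j"
  using j
proof (induction j rule: less_induct)
  case (less j)
  define J where "J = jordan_matrix n_as"
  have T: "T \<in> carrier_mat n n" using similar_mat_witD2[OF A w] by simp
  have col: "col T k \<in> carrier_vec n" for k using T by auto
  let ?c = "J $$ (j, j)"
  define M where "M = A - ?c \<cdot>\<^sub>m 1\<^sub>m n"
  have M: "M \<in> carrier_mat n n" using A unfolding M_def by auto
  have NM: "normal_mat M" unfolding M_def by (rule normal_mat_shift[OF A N])
  have Mv: "M *\<^sub>v v = A *\<^sub>v v - ?c \<cdot>\<^sub>v v" if "v \<in> carrier_vec n" for v
    unfolding M_def by (rule shift_mult_vec[OF A that])
  from jordan_basis_column[OF A w less.prems, folded J_def] show ?case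
    unfolding J_def[symmetric]
  \<comment> \<open>The first alternative is the goal itself; only a column with a chain predecessor
    remains.\<close>
  proof (elim disjE exE conjE)
    fix i
    assume i: "j = Suc i" "J $$ (i, i) = ?c"
      and *: "A *\<^sub>v col T j = ?c \<cdot>\<^sub>v col T j + J $$ (i, j) \<cdot>\<^sub>v col T i"
    have "A *\<^sub>v col T i = ?c \<cdot>\<^sub>v col T i" using less.IH[of i] less.prems i by (simp add: J_def)
    then have Mi: "M *\<^sub>v col T i = 0\<^sub>v n" using Mv[OF col] T by (auto simp: carrier_vecI)
    have Mj: "M *\<^sub>v col T j = J $$ (i, j) \<cdot>\<^sub>v col T i"
      unfolding Mv[OF col] * using T by (intro eq_vecI) auto
    have "M *\<^sub>v (M *\<^sub>v col T j) = J $$ (i, j) \<cdot>\<^sub>v (M *\<^sub>v col T i)"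
      unfolding Mj by (rule mult_mat_vec[OF M col])
    also have "\<dots> = 0\<^sub>v n" unfolding Mi by (intro eq_vecI) auto
    finally have "M *\<^sub>v col T j = 0\<^sub>v n" by (rule normal_mat_kernel_square[OF M NM col])
    \<comment> \<open>The surplus term vanishes as a vector, which reduces \<open>*\<close> to the
      eigenvalue equation.\<close>
    then have "J $$ (i, j) \<cdot>\<^sub>v col T i = 0\<^sub>v n" unfolding Mj .
    then show "A *\<^sub>v col T j = ?c \<cdot>\<^sub>v col T j"
      unfolding * using right_zero_vec[of "?c \<cdot>\<^sub>v col T j" n] col by simp
  qed
qed

lemma normal_mat_is_mat_conj:
  assumes A: "A \<in> carrier_mat n n" and N: "normal_mat A" and C: "is_mat_conj A C"
  shows "C = mat_adjoint A"
proof -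
  obtain n_as T T' where wit: "similar_mat_wit A (jordan_matrix n_as) T T'"
    and C: "C = T * mat_diag (dim_row A) (\<lambda>i. cnj (jordan_matrix n_as $$ (i, i))) * T'"
    using C unfolding is_mat_conj_def by blast
  note w = similar_mat_witD2[OF A wit]
  define d where "d i = cnj (jordan_matrix n_as $$ (i, i))" for i
  have B: "mat_adjoint A \<in> carrier_mat n n" by (rule mat_adjoint_carrier[OF A])
  \<comment> \<open>Compared column by column: column j of T is an eigenvector of the adjoint for
    \<open>d j\<close>. Multiplying by \<open>T'\<close> on the right then recovers C.\<close>
  have "mat_adjoint A * T = T * mat_diag n d"
  proof (rule mat_col_eqI)
    fix j assume "j < dim_col (T * mat_diag n d)"
    then have j: "j < n" using mat_diag_dim[of n d] by auto
    have v: "col T j \<in> carrier_vec n" using w(6) by auto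
    have "col (mat_adjoint A * T) j = mat_adjoint A *\<^sub>v col T j" by (rule col_mult2[OF B w(6) j])
    also have "\<dots> = d j \<cdot>\<^sub>v col T j"
      unfolding d_def
      by (intro normal_mat_eigenvector_adjoint[OF A N v]
          normal_mat_jordan_basis_eigenvector[OF A N wit j])
    also have "\<dots> = col (T * mat_diag n d) j"
      unfolding mat_diag_mult_right[OF w(6)] using w(6) j by (intro eq_vecI) auto
    finally show "col (mat_adjoint A * T) j = col (T * mat_diag n d) j" .
  qed (use B w(6) carrier_matD[OF mat_diag_dim[of n d]] in auto)
  then have "C = mat_adjoint A * T * T'" using A C unfolding d_def by simp
  also have "\<dots> = mat_adjoint A" using B w(1,6,7) by (simp add: assoc_mult_mat[of _ n n _ n _ n])
  finally show ?thesis .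
qed

theorem mainTheorem1:
  fixes A :: "complex mat" and n :: nat
  assumes "A \<in> carrier_mat n n"
  shows "mat_conj A = mat_adjoint A \<longleftrightarrow> normal_mat A"
proof
  assume "mat_conj A = mat_adjoint A"
  \<comment> \<open>Replacing the conjugate by the adjoint in its commutation with A gives exactly
    the defining equation of normality.\<close>
  then show "normal_mat A"
    using is_mat_conj_commute[OF assms is_mat_conj_mat_conj[OF assms]] by (simp add: normal_mat_def)
next
  assume "normal_mat A"
  then show "mat_conj A = mat_adjoint A"
    by (rule normal_mat_is_mat_conj[OF assms _ is_mat_conj_mat_conj[OF assms]])
qed

end
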